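(* Let $\mathbb G=(G,\partial G,E,\mu,g)$ and $\mathbb G'=(G',\partial G',E',\mu',g')$ be two finite, strongly connected, weighted graphs with boundary, both satisfying the Two-Points Condition and the Boundary-Triangle Condition (defined in the context). Let $q:G\to\mathbb R$ and $q':G'\to\mathbb R$ be potential functions. Suppose $(\mathbb G,q)$ is spectrally isomorphic to $(\mathbb G',q')$ with a boundary-isomorphism $\Phi_0$. Then there exists a bijection $\Phi:G\cup\partial G\to G'\cup\partial G'$ such that (1) $\Phi|_{\partial G}=\Phi_0|_{\partial G}$; (2) for any pair of vertices $x_1,x_2$ of $\mathbb G$, $x_1\sim x_2$ if and only if $\Phi(x_1)\sim'\Phi(x_2)$, where $\sim'$ is the edge relation of $\mathbb G'$.
   Context: A weighted graph with boundary $\mathbb G=(G,\partial G,E,\mu,g)$ consists of disjoint sets $G$ (interior vertices) and $\partial G$ (boundary vertices), a set $E$ of two-element subsets of $G\cup\partial G$ (edges; the graph $(G\cup\partial G,E)$ is undirected and simple), a vertex weight $\mu:G\cup\partial G\to(0,\infty)$ and an edge weight $g:E\to(0,\infty)$. Write $x\sim y$ if $\{x,y\}\in E$, $g_{xy}=g_{yx}$ for the weight of that edge, $\mu_x=\mu(x)$. $\mathbb G$ is finite (connected) if $(G\cup\partial G,E)$ is; it is strongly connected if it is still connected after removing all edges joining two boundary vertices. $d(x,y)$ is the minimal number of edges in a path from $x$ to $y$ in $(G\cup\partial G,E)$ ($\infty$ if there is none). $N(\partial G)=\partial G\cup\{x\in G: x\sim z\text{ for some }z\in\partial G\}$. For $S\subseteq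 G$, a point $x_0\in S$ is an extreme point of $S$ if there is $z\in\partial G$ such that $x_0$ is the unique nearest point in $S$ from $z$ with respect to $d$. Two-Points Condition: every subset $S\subseteq G$ with $|S|\ge2$ has at least two extreme points. Boundary-Triangle Condition: for any $z\in\partial G$ and any distinct $x,y\in G$, if $x\sim z$ and $y\sim z$ then $x\sim y$. For $u:G\cup\partial G\to\mathbb R$: $(\Delta_Gu)(x)=\frac1{\mu_x}\sum_{y\sim x,\,y\in G\cup\partial G}g_{xy}(u(y)-u(x))$ for $x\in G$, and $(\partial_\nu u)(z)=\frac1{\mu_z}\sum_{x\sim z,\,x\in G}g_{xz}(u(x)-u(z))$ for $z\in\partial G$. $L^2(G)$ is equipped with $\langle u_1,u_2\rangle_{L^2(G)}=\sum_{x\in G}\mu_xu_1(x)u_2(x)$. Neumann boundary spectral data of $(\mathbb G,q)$: a collection $(\lambda_j,\phi_j|_{\partial G})_{j=1}^N$, $N=|G|$, with $\lambda_j\in\mathbb R$, $\phi_j:G\cup\partial G\to\mathbb R$, $(-\Delta_G+q)\phi_j=\lambda_j\phi_j$ on $G$, $\partial_\nu\phi_j|_{\partial G}=0$, and $\{\phi_j\}$ an orthonormal basis of $L^2(G)$. A boundary-isomorphism is a bijection $\Phi_0:N(\partial G)\to N(\partial G')$ such that $\Phi_0|_{\partial G}:\partial G\to\partial G'$ is bijective and, for all $z\in\partial G$, $y\in N(\partial G)$: $y\sim z$ iff $\Phi_0(y)\sim'\Phi_0(z)$. $(\mathbb G,q)$ is spectrally isomorphic to $(\mathbb G',q')$ with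 boundary-isomorphism $\Phi_0$ if $\Phi_0$ is a boundary-isomorphism, the two Neumann boundary spectral data have the same number of eigenvalues counting multiplicities, and there is a choice of Neumann boundary spectral data of both such that $\lambda_j=\lambda_j'$ and $\phi_j|_{\partial G}=\phi_j'\circ\Phi_0|_{\partial G}$ for all $j$. *)

theory Defs
  imports Complex_Main "HOL-Library.Extended_Nat"
begin

text \<open>
  Functions on vertices, edges or vertex subsets are represented by total functions; only their
  values on the relevant carrier set are ever constrained.
\<close>

record 'a wgraph =
  inner_verts :: "'a set"
  bdry_verts :: "'a set"
  edge_set :: "'a set set"
  vertex_weight :: "'a \<Rightarrow> real"
  edge_weight :: "'a set \<Rightarrow> real"

definition verts :: "'a wgraph \<Rightarrow> 'a set" where
  "verts W = inner_verts W \<union> bdry_verts W"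

definition weighted_graph_with_boundary :: "'a wgraph \<Rightarrow> bool" where
  "weighted_graph_with_boundary W \<longleftrightarrow>
     inner_verts W \<inter> bdry_verts W = {} \<and>
     (\<forall>e\<in>edge_set W. e \<subseteq> verts W \<and> card e = 2) \<and>
     (\<forall>x\<in>verts W. vertex_weight W x > 0) \<and>
     (\<forall>e\<in>edge_set W. edge_weight W e > 0)"

definition finite_wgraph :: "'a wgraph \<Rightarrow> bool" where
  "finite_wgraph W \<longleftrightarrow> finite (verts W)"

definition adj :: "'a wgraph \<Rightarrow> 'a \<Rightarrow> 'a \<Rightarrow> bool" where
  "adj W x y \<longleftrightarrow> {x, y} \<in> edge_set W"

text \<open>A path is the list of its vertices, so a path \<open>p\<close> has \<open>length p - 1\<close> edges.\<close>

definition path_from_to :: "'a wgraph \<Rightarrow> 'a \<Rightarrow> 'a \<Rightarrow> 'a list \<Rightarrow> bool" where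
  "path_from_to W x y p \<longleftrightarrow>
     p \<noteq> [] \<and> set p \<subseteq> verts W \<and> successively (adj W) p \<and> hd p = x \<and> last p = y"

text \<open>The infimum of the empty set in \<^typ>\<open>enat\<close> is \<open>\<infinity>\<close>.\<close>

definition graph_dist :: "'a wgraph \<Rightarrow> 'a \<Rightarrow> 'a \<Rightarrow> enat" where
  "graph_dist W x y = (INF p\<in>{p. path_from_to W x y p}. enat (length p - 1))"

definition connected_wgraph :: "'a wgraph \<Rightarrow> bool" where
  "connected_wgraph W \<longleftrightarrow> (\<forall>x\<in>verts W. \<forall>y\<in>verts W. \<exists>p. path_from_to W x y p)"

definition remove_bdry_edges :: "'a wgraph \<Rightarrow> 'a wgraph" where
  "remove_bdry_edges W = W\<lparr>edge_set := {e \<in> edge_set W. \<not> e \<subseteq> bdry_verts W}\<rparr>"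

definition strongly_connected_wgraph :: "'a wgraph \<Rightarrow> bool" where
  "strongly_connected_wgraph W \<longleftrightarrow> connected_wgraph (remove_bdry_edges W)"

definition bdry_nbhd :: "'a wgraph \<Rightarrow> 'a set" where
  "bdry_nbhd W = bdry_verts W \<union> {x \<in> inner_verts W. \<exists>z\<in>bdry_verts W. adj W x z}"

definition extreme_point_of_subset :: "'a wgraph \<Rightarrow> 'a set \<Rightarrow> 'a \<Rightarrow> bool" where
  "extreme_point_of_subset W S x0 \<longleftrightarrow>
     x0 \<in> S \<and> (\<exists>z\<in>bdry_verts W. \<forall>y\<in>S - {x0}. graph_dist W z x0 < graph_dist W z y)"

text \<open>
  ``At least two'' is expressed through distinct elements rather than \<^const>\<open>card\<close>, so that the
  condition is also meaningful for infinite \<open>S\<close>.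
\<close>

definition two_points_condition :: "'a wgraph \<Rightarrow> bool" where
  "two_points_condition W \<longleftrightarrow>
     (\<forall>S \<subseteq> inner_verts W. (\<exists>x\<in>S. \<exists>y\<in>S. x \<noteq> y) \<longrightarrow>
        (\<exists>x y. x \<noteq> y \<and> extreme_point_of_subset W S x \<and> extreme_point_of_subset W S y))"

definition boundary_triangle_condition :: "'a wgraph \<Rightarrow> bool" where
  "boundary_triangle_condition W \<longleftrightarrow>
     (\<forall>z\<in>bdry_verts W. \<forall>x\<in>inner_verts W. \<forall>y\<in>inner_verts W.
        x \<noteq> y \<and> adj W x z \<and> adj W y z \<longrightarrow> adj W x y)"

definition graph_laplacian :: "'a wgraph \<Rightarrow> ('a \<Rightarrow> real) \<Rightarrow> 'a \<Rightarrow> real" where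
  "graph_laplacian W u x =
     1 / vertex_weight W x * (\<Sum>y | y \<in> verts W \<and> adj W y x. edge_weight W {x, y} * (u y - u x))"

definition neumann_deriv :: "'a wgraph \<Rightarrow> ('a \<Rightarrow> real) \<Rightarrow> 'a \<Rightarrow> real" where
  "neumann_deriv W u z =
     1 / vertex_weight W z * (\<Sum>x | x \<in> inner_verts W \<and> adj W x z. edge_weight W {x, z} * (u x - u z))"

definition L2_inner :: "'a wgraph \<Rightarrow> ('a \<Rightarrow> real) \<Rightarrow> ('a \<Rightarrow> real) \<Rightarrow> real" where
  "L2_inner W u v = (\<Sum>x\<in>inner_verts W. vertex_weight W x * u x * v x)"

definition L2_orthonormal_basis :: "'a wgraph \<Rightarrow> 'i set \<Rightarrow> ('i \<Rightarrow> 'a \<Rightarrow> real) \<Rightarrow> bool" where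
  "L2_orthonormal_basis W J \<phi> \<longleftrightarrow>
     (\<forall>i\<in>J. \<forall>j\<in>J. L2_inner W (\<phi> i) (\<phi> j) = (if i = j then 1 else 0)) \<and>
     (\<forall>u. \<exists>c. \<forall>x\<in>inner_verts W. u x = (\<Sum>j\<in>J. c j * \<phi> j x))"

text \<open>
  \<open>\<phi> j\<close> is the eigenfunction on all vertices; the boundary data proper are its values on
  \<open>bdry_verts W\<close>, and these are what spectral isomorphism compares.
\<close>

definition neumann_boundary_spectral_data ::
  "'a wgraph \<Rightarrow> ('a \<Rightarrow> real) \<Rightarrow> (nat \<Rightarrow> real) \<Rightarrow> (nat \<Rightarrow> 'a \<Rightarrow> real) \<Rightarrow> bool" where
  "neumann_boundary_spectral_data W q eigval \<phi> \<longleftrightarrow>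
     (\<forall>j\<in>{1..card (inner_verts W)}.
        (\<forall>x\<in>inner_verts W. - graph_laplacian W (\<phi> j) x + q x * \<phi> j x = eigval j * \<phi> j x) \<and>
        (\<forall>z\<in>bdry_verts W. neumann_deriv W (\<phi> j) z = 0)) \<and>
     L2_orthonormal_basis W {1..card (inner_verts W)} \<phi>"

definition boundary_isomorphism :: "'a wgraph \<Rightarrow> 'b wgraph \<Rightarrow> ('a \<Rightarrow> 'b) \<Rightarrow> bool" where
  "boundary_isomorphism W W' \<Phi>0 \<longleftrightarrow>
     bij_betw \<Phi>0 (bdry_nbhd W) (bdry_nbhd W') \<and>
     bij_betw \<Phi>0 (bdry_verts W) (bdry_verts W') \<and>
     (\<forall>z\<in>bdry_verts W. \<forall>y\<in>bdry_nbhd W. adj W y z \<longleftrightarrow> adj W' (\<Phi>0 y) (\<Phi>0 z))"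

definition spectrally_isomorphic ::
  "'a wgraph \<Rightarrow> ('a \<Rightarrow> real) \<Rightarrow> 'b wgraph \<Rightarrow> ('b \<Rightarrow> real) \<Rightarrow> ('a \<Rightarrow> 'b) \<Rightarrow> bool" where
  "spectrally_isomorphic W q W' q' \<Phi>0 \<longleftrightarrow>
     boundary_isomorphism W W' \<Phi>0 \<and>
     card (inner_verts W) = card (inner_verts W') \<and>
     (\<exists>eigval \<phi> eigval' \<phi>'.
        neumann_boundary_spectral_data W q eigval \<phi> \<and>
        neumann_boundary_spectral_data W' q' eigval' \<phi>' \<and>
        (\<forall>j\<in>{1..card (inner_verts W)}.
           eigval j = eigval' j \<and> (\<forall>z\<in>bdry_verts W. \<phi> j z = \<phi>' j (\<Phi>0 z))))"

end

theory Submission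
  imports Defs
begin

text \<open>
  The idea is to read off the interior vertices from positivity. Write \<open>J\<close> for the index set of
  the eigenfunctions. For a shift \<open>s\<close> above the diagonal of the operator \<open>A = -\<Delta> + q\<close> (with
  boundary values eliminated by the Neumann condition), \<open>s - A\<close> has nonnegative entries, and so
  the kernels \<open>k\<^sub>n(x, y) = \<Sum>\<^sub>j (s - \<lambda>\<^sub>j)\<^sup>n \<phi>\<^sub>j(x) \<phi>\<^sub>j(y)\<close> of its powers are nonnegative on
  interior and boundary vertices alike. They propagate with unit speed: \<open>k\<^sub>n(x, z)\<close>, for \<open>x\<close>
  interior and \<open>z\<close> on the boundary, vanishes unless \<open>x\<close> and \<open>z\<close> are joined by a path with at most
  \<open>n + 1\<close> edges, and it is positive when such a path with exactly \<open>n + 1\<close> edges runs through the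
  interior. Hence an extreme point of a set \<open>S\<close> is separated from the rest of \<open>S\<close> by some function
  \<open>x \<mapsto> k\<^sub>n(x, z)\<close> (\<open>extreme_point_isolated_by_kernel\<close>).

  Send every interior vertex \<open>x\<close> to the vector \<open>(\<surd>\<mu>\<^sub>x \<phi>\<^sub>j(x))\<^sub>j\<close>. Each of the two graphs
  thereby becomes an orthonormal basis of the same space \<open>\<real>\<^sup>J\<close>, and the common vectors
  \<open>((s - \<lambda>\<^sub>j)\<^sup>n \<phi>\<^sub>j(z))\<^sub>j\<close>, which only depend on the boundary spectral data, have nonnegative
  coordinates in both bases. By the Two-Points Condition they isolate two points of every set of at
  least two interior vertices. Under these circumstances the orthogonal matrix relating the two
  bases has a single nonzero entry in each row
  (\<open>nonneg_isolating_orthogonal_matrix_is_monomial\<close>), so the two bases agree up to order and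
  scalar factors. This yields the bijection of the interior vertices.

  Under it the kernels of the two graphs agree up to nonzero factors, and the edges are visible in
  them: for interior \<open>x \<noteq> y\<close> the Boundary-Triangle Condition ensures that \<open>x \<sim> y\<close> exactly if
  \<open>k\<^sub>1(x, y) \<noteq> 0\<close>, and for a boundary vertex \<open>z\<close>, \<open>x \<sim> z\<close> exactly if \<open>k\<^sub>0(x, z) \<noteq> 0\<close>.
\<close>

section \<open>Orthogonal matrices and isolating nonnegative vectors\<close>

text \<open>
  Call a row matched if it carries the only nonzero entry of some column; that entry is then also
  the only one in its row. View \<open>a\<close> and \<open>b\<close> as the coordinates of one vector in two orthonormal bases.
  Suppose that the set \<open>S\<close> of unmatched rows is nonempty, and let some \<open>a\<close> isolate \<open>x \<in> S\<close>.
  For a column \<open>v\<close> supported in \<open>S\<close>, the coordinate \<open>b v\<close> reduces to \<open>Q x v * a x\<close>, so row \<open>x\<close> is nonnegative. Consequently any vector with \<open>a x = 0\<close> must have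
  \<open>b v = 0\<close> wherever \<open>Q x v > 0\<close>, because \<open>a x = 0\<close> is the sum of the nonnegative \<open>Q x v * b v\<close>. But
  if the support of such a column \<open>v\<close> were more than \<open>{x}\<close>, a vector isolating another point of
  this support would violate this. So row \<open>x\<close> is matched after all.
\<close>

lemma nonneg_isolating_orthogonal_matrix_is_monomial:
  fixes Q :: "'a \<Rightarrow> 'b \<Rightarrow> real" and a :: "'i \<Rightarrow> 'a \<Rightarrow> real" and b :: "'i \<Rightarrow> 'b \<Rightarrow> real"
  assumes fin: "finite X" "finite Y"
    and rows: "\<And>x y. x \<in> X \<Longrightarrow> y \<in> X \<Longrightarrow> (\<Sum>v\<in>Y. Q x v * Q y v) = (if x = y then 1 else 0)"
    and cols: "\<And>u v. u \<in> Y \<Longrightarrow> v \<in> Y \<Longrightarrow> (\<Sum>x\<in>X. Q x u * Q x v) = (if u = v then 1 else 0)"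
    and image: "\<And>i v. i \<in> I \<Longrightarrow> v \<in> Y \<Longrightarrow> b i v = (\<Sum>x\<in>X. Q x v * a i x)"
    and a_nonneg: "\<And>i x. i \<in> I \<Longrightarrow> x \<in> X \<Longrightarrow> a i x \<ge> 0"
    and b_nonneg: "\<And>i v. i \<in> I \<Longrightarrow> v \<in> Y \<Longrightarrow> b i v \<ge> 0"
    and isolating: "\<And>S. S \<subseteq> X \<Longrightarrow> \<exists>x\<in>S. \<exists>y\<in>S. x \<noteq> y \<Longrightarrow>
      \<exists>x\<in>S. \<exists>y\<in>S. x \<noteq> y \<and>
        (\<exists>i\<in>I. a i x > 0 \<and> (\<forall>w\<in>S - {x}. a i w = 0)) \<and>
        (\<exists>i\<in>I. a i y > 0 \<and> (\<forall>w\<in>S - {y}. a i w = 0))"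
    and "x0 \<in> X"
  shows "\<exists>v\<in>Y. Q x0 v \<noteq> 0 \<and> (\<forall>y\<in>X - {x0}. Q y v = 0)"
proof (rule ccontr)
  assume contra: "\<not> ?thesis"
  define matched where "matched x v \<longleftrightarrow> Q x v \<noteq> 0 \<and> (\<forall>y\<in>X - {x}. Q y v = 0)" for x v
  define S where "S = {x\<in>X. \<not> (\<exists>v\<in>Y. matched x v)}"
  have "S \<subseteq> X" "x0 \<in> S"
    using contra \<open>x0 \<in> X\<close> by (auto simp: S_def matched_def)
  have single_row: "Q x u = 0" if "x \<in> X" "v \<in> Y" "matched x v" "u \<in> Y" "u \<noteq> v" for x u v
  proof -
    have "(\<Sum>y\<in>X. Q y v * Q y u) = Q x v * Q x u"
      using that fin by (subst sum.remove[of X x]) (auto simp: matched_def)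
    with cols[of v u] that show ?thesis by (auto simp: matched_def)
  qed
  \<comment> \<open>A column that meets an unmatched row vanishes on all matched rows: otherwise it would be the
    column of a matched entry, which has no second nonzero entry.\<close>
  have column_in_S: "Q y v = 0" if "x \<in> S" "v \<in> Y" "Q x v \<noteq> 0" "y \<in> X - S" for x y v
  proof -
    have "\<exists>u\<in>Y. matched y u" using that(4) unfolding S_def by blast
    then obtain u where u: "u \<in> Y" "matched y u" by blast
    have "u \<noteq> v" using that u by (auto simp: matched_def S_def)
    then show ?thesis using single_row[of y u v] u that by auto
  qed
  have nonzero_entry: "\<exists>v\<in>Y. Q x v \<noteq> 0" if "x \<in> X" for x
  proof (rule ccontr)
    assume "\<not> ?thesis"
    then have "(\<Sum>v\<in>Y. Q x v * Q x v) = 0" by (simp add: sum.neutral)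
    with rows[of x x] that show False by simp
  qed
  \<comment> \<open>A single unmatched row is impossible, since any nonzero entry in it would be alone in its column.\<close>
  have "\<exists>x\<in>S. \<exists>y\<in>S. x \<noteq> y"
  proof (rule ccontr)
    assume "\<not> ?thesis"
    then have S: "S = {x0}" using \<open>x0 \<in> S\<close> by auto
    obtain v where "v \<in> Y" "Q x0 v \<noteq> 0" using nonzero_entry \<open>x0 \<in> X\<close> by blast
    then show False using column_in_S[of x0 v] S contra by auto
  qed
  from isolating[OF \<open>S \<subseteq> X\<close> this] obtain x i
    where x: "x \<in> S" "i \<in> I" "a i x > 0" "\<forall>w\<in>S - {x}. a i w = 0" by blast
  have "x \<in> X" using x \<open>S \<subseteq> X\<close> by blast
  have row_nonneg: "Q x v \<ge> 0" if "v \<in> Y" for v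
  proof (cases "Q x v = 0")
    case False
    have "b i v = (\<Sum>w\<in>X. Q w v * a i w)" using image x that by blast
    also have "\<dots> = (\<Sum>w\<in>{x}. Q w v * a i w)"
      using x column_in_S[OF x(1) that False] \<open>x \<in> X\<close> fin
      by (intro sum.mono_neutral_right) auto
    finally have "Q x v * a i x \<ge> 0" using b_nonneg[OF x(2) that] by simp
    then show ?thesis using x(3) by (simp add: zero_le_mult_iff)
  qed simp
  obtain v where v: "v \<in> Y" "Q x v > 0"
    using nonzero_entry[OF \<open>x \<in> X\<close>] row_nonneg by (metis order_le_less)
  define R where "R = {y\<in>X. Q y v \<noteq> 0}"
  have "x \<in> R" using v \<open>x \<in> X\<close> by (auto simp: R_def)
  have "\<not> matched x v" using x(1) v by (auto simp: S_def)
  then have "\<exists>x\<in>R. \<exists>y\<in>R. x \<noteq> y"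
    using \<open>x \<in> R\<close> v by (fastforce simp: matched_def R_def)
  moreover have "R \<subseteq> X" by (auto simp: R_def)
  \<comment> \<open>Of the two isolated points of \<open>R\<close>, at least one differs from \<open>x\<close>.\<close>
  ultimately obtain y k where y: "y \<in> R" "y \<noteq> x" "k \<in> I" "a k y > 0" "\<forall>w\<in>R - {y}. a k w = 0"
    using isolating[of R] by metis
  have "b k v = (\<Sum>w\<in>X. Q w v * a k w)" using image y v by blast
  also have "\<dots> = (\<Sum>w\<in>{y}. Q w v * a k w)"
    using y fin by (intro sum.mono_neutral_right) (auto simp: R_def)
  finally have "b k v \<noteq> 0" using y by (auto simp: R_def)
  \<comment> \<open>Orthogonality inverts the change of coordinates, so row \<open>x\<close> recovers \<open>a k x\<close> from \<open>b k\<close>.\<close>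
  have "(\<Sum>u\<in>Y. Q x u * b k u) = (\<Sum>u\<in>Y. \<Sum>w\<in>X. Q x u * Q w u * a k w)"
    using image y by (intro sum.cong) (auto simp: sum_distrib_left mult.assoc)
  also have "\<dots> = (\<Sum>w\<in>X. (\<Sum>u\<in>Y. Q x u * Q w u) * a k w)"
    by (subst sum.swap) (simp add: sum_distrib_right)
  also have "\<dots> = a k x"
    using rows \<open>x \<in> X\<close> fin by (simp add: if_distrib[of "\<lambda>c. c * _"] cong: if_cong)
  also have "\<dots> = 0" using y \<open>x \<in> R\<close> by auto
  finally have "Q x v * b k v = 0"
    using v row_nonneg b_nonneg[OF y(3)] fin by (subst (asm) sum_nonneg_eq_0_iff) auto
  then show False using v \<open>b k v \<noteq> 0\<close> by simp
qed

section \<open>Paths\<close>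

lemma adj_sym: "adj W x y \<Longrightarrow> adj W y x"
  by (simp add: adj_def insert_commute)

lemma path_from_to_rev: "path_from_to W x y p \<Longrightarrow> path_from_to W y x (rev p)"
  by (auto simp: path_from_to_def hd_rev last_rev intro: successively_mono adj_sym)

lemma path_from_to_snoc:
  "path_from_to W x y p \<Longrightarrow> adj W y w \<Longrightarrow> w \<in> verts W \<Longrightarrow> path_from_to W x w (p @ [w])"
  by (auto simp: path_from_to_def successively_append_iff)

lemma path_from_to_append_tl:
  assumes "path_from_to W x z (p @ [z])" "path_from_to W z y r"
  shows "path_from_to W x y (p @ r)"
  using assms by (auto simp: path_from_to_def successively_append_iff hd_append)

lemma graph_dist_le: "path_from_to W x y p \<Longrightarrow> graph_dist W x y \<le> enat (length p - 1)"
  unfolding graph_dist_def by (rule INF_lower) simp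

lemma shortest_path:
  assumes "graph_dist W x y \<noteq> \<infinity>"
  obtains p where "path_from_to W x y p" "graph_dist W x y = enat (length p - 1)"
proof -
  let ?L = "(\<lambda>p. enat (length p - 1)) ` {p. path_from_to W x y p}"
  have "?L \<noteq> {}"
    using assms unfolding graph_dist_def by (metis Inf_enat_def)
  then have "Inf ?L \<in> ?L"
    by (metis all_not_in_conv wellorder_InfI)
  then show ?thesis using that by (auto simp: graph_dist_def)
qed

section \<open>Spectral kernels of one graph\<close>

locale neumann_eigenbasis =
  fixes W :: "'a wgraph" and q :: "'a \<Rightarrow> real" and ev :: "nat \<Rightarrow> real" and \<phi> :: "nat \<Rightarrow> 'a \<Rightarrow> real"
  assumes graph: "weighted_graph_with_boundary W"
    and finite_graph: "finite_wgraph W"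
    and strongly_connected: "strongly_connected_wgraph W"
    and triangle: "boundary_triangle_condition W"
    and spectral: "neumann_boundary_spectral_data W q ev \<phi>"
begin

abbreviation "G \<equiv> inner_verts W"
abbreviation "B \<equiv> bdry_verts W"
abbreviation "\<mu> \<equiv> vertex_weight W"
abbreviation "g x y \<equiv> edge_weight W {x, y}"
abbreviation "J \<equiv> {1..card G}"

text \<open>
  For interior \<open>x\<close>, the function \<open>spectral_kernel s n x\<close> is \<open>(s - A)\<^sup>n\<close> applied to the unit mass
  at \<open>x\<close>, divided by \<open>\<mu>\<^sub>x\<close>, where \<open>A = -\<Delta> + q\<close>, extended to the boundary by the Neumann
  condition.
\<close>

definition spectral_kernel :: "real \<Rightarrow> nat \<Rightarrow> 'a \<Rightarrow> 'a \<Rightarrow> real" where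
  "spectral_kernel s n x y = (\<Sum>j\<in>J. (s - ev j) ^ n * \<phi> j x * \<phi> j y)"

text \<open>
  The quantity bounded by \<open>s\<close> is the coefficient of \<open>u y\<close> in \<open>(-\<Delta> + q) u\<close> at \<open>y\<close>, before boundary
  values are eliminated. Elimination only lowers the diagonal, so such an \<open>s\<close> makes every
  coefficient of \<open>s - A\<close> nonnegative.
\<close>

definition diagonal_bound :: "real \<Rightarrow> bool" where
  "diagonal_bound s \<longleftrightarrow> (\<forall>y\<in>G. q y + 1 / \<mu> y * (\<Sum>w | w \<in> verts W \<and> adj W w y. g y w) \<le> s)"

lemma disjoint: "G \<inter> B = {}"
  using graph by (simp add: weighted_graph_with_boundary_def)

lemma finite_sets [simp]: "finite (verts W)" "finite G" "finite B"
  using finite_graph by (auto simp: finite_wgraph_def verts_def)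

lemma adj_verts: "adj W x y \<Longrightarrow> x \<in> verts W \<and> y \<in> verts W \<and> x \<noteq> y"
  using graph by (fastforce simp: weighted_graph_with_boundary_def adj_def)

lemma \<mu>_pos: "x \<in> verts W \<Longrightarrow> \<mu> x > 0"
  using graph by (simp add: weighted_graph_with_boundary_def)

lemma g_pos: "adj W x y \<Longrightarrow> g x y > 0"
  using graph by (simp add: weighted_graph_with_boundary_def adj_def)

lemma g_pos_sym: "adj W y x \<Longrightarrow> g x y > 0"
  using g_pos[of y x] by (simp add: insert_commute)

lemma orthonormal:
  "i \<in> J \<Longrightarrow> j \<in> J \<Longrightarrow> (\<Sum>x\<in>G. \<mu> x * \<phi> i x * \<phi> j x) = (if i = j then 1 else 0)"
  using spectral
  by (simp add: neumann_boundary_spectral_data_def L2_orthonormal_basis_def L2_inner_def)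

lemma eigenfunction:
  "j \<in> J \<Longrightarrow> x \<in> G \<Longrightarrow> ev j * \<phi> j x = - graph_laplacian W (\<phi> j) x + q x * \<phi> j x"
  using spectral by (simp add: neumann_boundary_spectral_data_def)

lemma neumann_condition: "j \<in> J \<Longrightarrow> z \<in> B \<Longrightarrow> neumann_deriv W (\<phi> j) z = 0"
  using spectral by (simp add: neumann_boundary_spectral_data_def)

text \<open>
  The indicator of \<open>x\<close> is a combination of the eigenfunctions by the spanning property, and
  orthonormality forces its coefficients to be \<open>\<mu>\<^sub>x \<phi>\<^sub>j(x)\<close>. So for \<open>n = 0\<close> the kernel is a
  multiple of the identity on interior vertices.
\<close>

lemma completeness:
  assumes "x \<in> G" "y \<in> G"
  shows "\<mu> x * (\<Sum>j\<in>J. \<phi> j x * \<phi> j y) = (if x = y then 1 else 0)"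
proof -
  have "\<forall>u. \<exists>c. \<forall>w\<in>G. u w = (\<Sum>j\<in>J. c j * \<phi> j w)"
    using spectral by (simp add: neumann_boundary_spectral_data_def L2_orthonormal_basis_def)
  from this[rule_format, of "\<lambda>w. if w = x then 1 else 0"] obtain c
    where c: "\<And>w. w \<in> G \<Longrightarrow> (if w = x then 1 else 0) = (\<Sum>j\<in>J. c j * \<phi> j w)" by blast
  have coeff: "c i = \<mu> x * \<phi> i x" if "i \<in> J" for i
  proof -
    have "\<mu> x * \<phi> i x = (\<Sum>w\<in>G. \<mu> w * \<phi> i w * (if w = x then 1 else 0))"
      using assms by (simp add: if_distrib[of "\<lambda>c. _ * c"] cong: if_cong)
    also have "\<dots> = (\<Sum>w\<in>G. \<Sum>j\<in>J. c j * (\<mu> w * \<phi> i w * \<phi> j w))"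
      using c by (intro sum.cong) (auto simp: sum_distrib_left mult_ac)
    also have "\<dots> = (\<Sum>j\<in>J. c j * (\<Sum>w\<in>G. \<mu> w * \<phi> i w * \<phi> j w))"
      by (subst sum.swap) (simp add: sum_distrib_left)
    also have "\<dots> = (\<Sum>j\<in>J. c j * (if i = j then 1 else 0))"
      using that by (intro sum.cong) (auto simp del: atLeastAtMost_iff simp: orthonormal)
    also have "\<dots> = c i"
      using that by (simp add: if_distrib[of "\<lambda>c. _ * c"] cong: if_cong)
    finally show ?thesis by simp
  qed
  have "\<mu> x * (\<Sum>j\<in>J. \<phi> j x * \<phi> j y) = (\<Sum>j\<in>J. c j * \<phi> j y)"
    by (auto simp: coeff sum_distrib_left mult.assoc intro!: sum.cong)
  also have "\<dots> = (if x = y then 1 else 0)"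
    using c[OF assms(2)] by auto
  finally show ?thesis .
qed

lemma parseval:
  "(\<Sum>x\<in>G. \<mu> x * (\<Sum>i\<in>J. a i * \<phi> i x) * (\<Sum>j\<in>J. b j * \<phi> j x)) = (\<Sum>j\<in>J. a j * b j)"
proof -
  have "(\<Sum>x\<in>G. \<mu> x * (\<Sum>i\<in>J. a i * \<phi> i x) * (\<Sum>j\<in>J. b j * \<phi> j x)) =
      (\<Sum>x\<in>G. \<Sum>i\<in>J. \<Sum>j\<in>J. a i * b j * (\<mu> x * \<phi> i x * \<phi> j x))"
    by (simp add: sum_distrib_left sum_distrib_right mult_ac)
  also have "\<dots> = (\<Sum>i\<in>J. \<Sum>j\<in>J. a i * b j * (\<Sum>x\<in>G. \<mu> x * \<phi> i x * \<phi> j x))"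
    by (subst sum.swap, intro sum.cong refl, subst sum.swap) (simp add: sum_distrib_left)
  also have "\<dots> = (\<Sum>i\<in>J. \<Sum>j\<in>J. a i * b j * (if i = j then 1 else 0))"
    by (intro sum.cong refl) (simp only: orthonormal)
  also have "\<dots> = (\<Sum>j\<in>J. a j * b j)"
    by (intro sum.cong refl) (simp add: if_distrib[of "\<lambda>c. _ * c"] cong: if_cong)
  finally show ?thesis .
qed

lemma kernel_0: "x \<in> G \<Longrightarrow> y \<in> G \<Longrightarrow> spectral_kernel s 0 x y = (if x = y then 1 / \<mu> x else 0)"
  using completeness[of x y] \<mu>_pos[of x] by (auto simp: spectral_kernel_def verts_def field_simps)

text \<open>
  One application of \<open>s - A\<close> in the second variable: the factor \<open>s - \<lambda>\<^sub>j\<close> is traded for the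
  operator by the eigenvalue equation.
\<close>

lemma kernel_Suc:
  assumes "y \<in> G"
  shows "spectral_kernel s (Suc n) x y =
     (s - (q y + 1 / \<mu> y * (\<Sum>w | w \<in> verts W \<and> adj W w y. g y w))) * spectral_kernel s n x y
     + 1 / \<mu> y * (\<Sum>w | w \<in> verts W \<and> adj W w y. g y w * spectral_kernel s n x w)"
proof -
  let ?N = "{w. w \<in> verts W \<and> adj W w y}"
  have step: "(s - ev j) * \<phi> j y = (s - (q y + 1 / \<mu> y * (\<Sum>w\<in>?N. g y w))) * \<phi> j y
      + 1 / \<mu> y * (\<Sum>w\<in>?N. g y w * \<phi> j w)" if "j \<in> J" for j
    using eigenfunction[OF that assms]
    by (simp add: graph_laplacian_def algebra_simps sum_subtractf sum_distrib_left)
  have "spectral_kernel s (Suc n) x y = (\<Sum>j\<in>J. (s - ev j) ^ n * \<phi> j x * ((s - ev j) * \<phi> j y))"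
    by (simp add: spectral_kernel_def mult_ac)
  also have "\<dots> = (\<Sum>j\<in>J. (s - (q y + 1 / \<mu> y * (\<Sum>w\<in>?N. g y w))) *
        ((s - ev j) ^ n * \<phi> j x * \<phi> j y)
      + 1 / \<mu> y * (\<Sum>w\<in>?N. g y w * ((s - ev j) ^ n * \<phi> j x * \<phi> j w)))"
    by (intro sum.cong refl, subst step) (simp_all add: algebra_simps sum_distrib_left)
  also have "\<dots> = (s - (q y + 1 / \<mu> y * (\<Sum>w\<in>?N. g y w))) * spectral_kernel s n x y
      + 1 / \<mu> y * (\<Sum>j\<in>J. \<Sum>w\<in>?N. g y w * ((s - ev j) ^ n * \<phi> j x * \<phi> j w))"
    by (simp add: sum.distrib spectral_kernel_def sum_distrib_left)
  also have "(\<Sum>j\<in>J. \<Sum>w\<in>?N. g y w * ((s - ev j) ^ n * \<phi> j x * \<phi> j w)) =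
      (\<Sum>w\<in>?N. g y w * spectral_kernel s n x w)"
    by (subst sum.swap) (simp add: spectral_kernel_def sum_distrib_left)
  finally show ?thesis .
qed

text \<open>The Neumann condition makes a boundary value the weighted mean of the interior neighbours.\<close>

lemma kernel_boundary:
  assumes "z \<in> B"
  shows "(\<Sum>y | y \<in> G \<and> adj W y z. g y z) * spectral_kernel s n x z =
    (\<Sum>y | y \<in> G \<and> adj W y z. g y z * spectral_kernel s n x y)"
proof -
  let ?N = "{y. y \<in> G \<and> adj W y z}"
  have step: "(\<Sum>y\<in>?N. g y z * \<phi> j y) = (\<Sum>y\<in>?N. g y z) * \<phi> j z" if "j \<in> J" for j
  proof -
    have "(\<Sum>y\<in>?N. g y z * (\<phi> j y - \<phi> j z)) = 0"
      using neumann_condition[OF that assms] \<mu>_pos[of z] assms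
      by (auto simp: neumann_deriv_def verts_def)
    then show ?thesis by (simp add: right_diff_distrib sum_subtractf sum_distrib_right)
  qed
  have "(\<Sum>y\<in>?N. g y z * spectral_kernel s n x y) =
      (\<Sum>j\<in>J. (s - ev j) ^ n * \<phi> j x * (\<Sum>y\<in>?N. g y z * \<phi> j y))"
    unfolding spectral_kernel_def sum_distrib_left by (subst sum.swap) (simp add: mult_ac)
  also have "\<dots> = (\<Sum>j\<in>J. (s - ev j) ^ n * \<phi> j x * ((\<Sum>y\<in>?N. g y z) * \<phi> j z))"
    by (intro sum.cong refl) (simp only: step)
  also have "\<dots> = (\<Sum>y\<in>?N. g y z) * spectral_kernel s n x z"
    unfolding spectral_kernel_def by (simp add: sum_distrib_left mult_ac)
  finally show ?thesis by simp
qed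

text \<open>
  This is where strong connectedness enters: without an interior neighbour the Neumann condition
  would leave the value at \<open>z\<close> arbitrary.
\<close>

lemma boundary_has_inner_neighbour:
  assumes "x \<in> G" "z \<in> B"
  shows "\<exists>y\<in>G. adj W y z"
proof -
  let ?R = "remove_bdry_edges W"
  have "verts ?R = verts W" by (simp add: verts_def remove_bdry_edges_def)
  then obtain p where p: "path_from_to ?R z x p"
    using strongly_connected assms
    by (fastforce simp: strongly_connected_wgraph_def connected_wgraph_def verts_def)
  obtain w r where "p = z # w # r"
    using p assms disjoint by (cases p; cases "tl p") (auto simp: path_from_to_def)
  then have "adj ?R z w" using p by (simp add: path_from_to_def)
  then have "adj W z w" "\<not> {z, w} \<subseteq> B" by (auto simp: adj_def remove_bdry_edges_def)
  then show ?thesis using assms adj_verts[of z w] by (auto simp: verts_def intro: adj_sym)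
qed

lemma inner_edge_weight_pos:
  assumes "x \<in> G" "z \<in> B"
  shows "(\<Sum>y | y \<in> G \<and> adj W y z. g y z) > 0"
  using boundary_has_inner_neighbour[OF assms] g_pos by (intro sum_pos) auto

lemma kernel_nonneg_boundaryI:
  assumes "x \<in> G" "z \<in> B" "\<And>y. y \<in> G \<Longrightarrow> spectral_kernel s n x y \<ge> 0"
  shows "spectral_kernel s n x z \<ge> 0"
proof -
  have "(\<Sum>y | y \<in> G \<and> adj W y z. g y z) * spectral_kernel s n x z \<ge> 0"
    unfolding kernel_boundary[OF assms(2)] using assms(3) g_pos
    by (intro sum_nonneg mult_nonneg_nonneg) (auto intro: less_imp_le)
  then show ?thesis using inner_edge_weight_pos[OF assms(1,2)] by (simp add: zero_le_mult_iff)
qed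

lemma kernel_nonneg:
  assumes "diagonal_bound s" "x \<in> G" "y \<in> verts W"
  shows "spectral_kernel s n x y \<ge> 0"
proof -
  have "spectral_kernel s n x y \<ge> 0" if "y \<in> G" for y
    using that
  proof (induction n arbitrary: y)
    case 0
    then show ?case using kernel_0 \<mu>_pos assms(2) by (auto simp: verts_def less_imp_le)
  next
    case (Suc n)
    have "spectral_kernel s n x w \<ge> 0" if "w \<in> verts W" for w
      using that Suc.IH kernel_nonneg_boundaryI[OF assms(2)] by (auto simp: verts_def)
    then show ?case
      unfolding kernel_Suc[OF Suc.prems]
      using assms(1) Suc \<mu>_pos[of y] less_imp_le[OF g_pos_sym]
      by (intro add_nonneg_nonneg mult_nonneg_nonneg sum_nonneg)
        (auto simp: diagonal_bound_def verts_def)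
  qed
  then show ?thesis
    using assms kernel_nonneg_boundaryI by (auto simp: verts_def)
qed

lemma kernel_Suc_pos:
  assumes "diagonal_bound s" "x \<in> G" "y \<in> G" "adj W y w" "spectral_kernel s n x w > 0"
  shows "spectral_kernel s (Suc n) x y > 0"
proof -
  have "(\<Sum>w | w \<in> verts W \<and> adj W w y. g y w * spectral_kernel s n x w) > 0"
    using assms adj_verts[of y w] g_pos[of y w] adj_sym[of W y w]
      less_imp_le[OF g_pos_sym] kernel_nonneg[OF assms(1,2)]
    by (intro sum_pos2[of _ w]) auto
  moreover have "(s - (q y + 1 / \<mu> y * (\<Sum>w | w \<in> verts W \<and> adj W w y. g y w))) * spectral_kernel s n x y \<ge> 0"
    using assms kernel_nonneg by (intro mult_nonneg_nonneg) (auto simp: diagonal_bound_def verts_def)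
  ultimately show ?thesis
    unfolding kernel_Suc[OF assms(3)] using \<mu>_pos[of y] assms(3)
    by (auto simp: verts_def intro!: add_nonneg_pos divide_pos_pos)
qed

lemma kernel_boundary_pos:
  assumes "diagonal_bound s" "x \<in> G" "z \<in> B" "y \<in> G" "adj W y z" "spectral_kernel s n x y > 0"
  shows "spectral_kernel s n x z > 0"
proof -
  have "(\<Sum>y | y \<in> G \<and> adj W y z. g y z * spectral_kernel s n x y) > 0"
    using assms g_pos[of y z] less_imp_le[OF g_pos] kernel_nonneg[OF assms(1,2)]
    by (intro sum_pos2[of _ y]) (auto simp: verts_def)
  then have "(\<Sum>y | y \<in> G \<and> adj W y z. g y z) * spectral_kernel s n x z > 0"
    using kernel_boundary[OF assms(3)] by simp
  then show ?thesis using inner_edge_weight_pos[OF assms(2,3)] by (simp add: zero_less_mult_iff)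
qed

lemma kernel_boundary_nonzero:
  assumes "x \<in> G" "z \<in> B" "spectral_kernel s n x z \<noteq> 0"
  obtains y where "y \<in> G" "adj W y z" "spectral_kernel s n x y \<noteq> 0"
proof -
  have "(\<Sum>y | y \<in> G \<and> adj W y z. g y z * spectral_kernel s n x y) \<noteq> 0"
    using inner_edge_weight_pos[OF assms(1,2)] assms(3)
    unfolding kernel_boundary[OF assms(2), symmetric] by simp
  then obtain y where "y \<in> G" "adj W y z" "g y z * spectral_kernel s n x y \<noteq> 0"
    by (metis (mono_tags, lifting) mem_Collect_eq sum.not_neutral_contains_not_neutral)
  then show ?thesis using that by simp
qed

text \<open>
  The operator also couples interior vertices that merely share a boundary neighbour, which would let
  the kernel advance two edges in one step. The Boundary-Triangle Condition says that such vertices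
  are adjacent, so it advances by a single edge.
\<close>

lemma kernel_Suc_nonzero:
  assumes "x \<in> G" "y \<in> G" "spectral_kernel s (Suc n) x y \<noteq> 0" "spectral_kernel s n x y = 0"
  obtains w where "w \<in> G" "adj W w y" "spectral_kernel s n x w \<noteq> 0"
proof -
  have "(\<Sum>w | w \<in> verts W \<and> adj W w y. g y w * spectral_kernel s n x w) \<noteq> 0"
    using assms(3,4) unfolding kernel_Suc[OF assms(2)] by auto
  then obtain w where w: "w \<in> verts W" "adj W w y" "spectral_kernel s n x w \<noteq> 0"
    by (metis (mono_tags, lifting) mem_Collect_eq mult_zero_right sum.not_neutral_contains_not_neutral)
  show ?thesis
  proof (cases "w \<in> G")
    case True
    then show ?thesis using w that by blast
  next
    case False
    then have "w \<in> B" using w by (simp add: verts_def)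
    from kernel_boundary_nonzero[OF assms(1) this w(3)] obtain v
      where v: "v \<in> G" "adj W v w" "spectral_kernel s n x v \<noteq> 0" .
    then have "adj W v y"
      using triangle \<open>w \<in> B\<close> w(2) assms(2,4)
      by (metis adj_sym boundary_triangle_condition_def)
    with v that show ?thesis by blast
  qed
qed

lemma kernel_inner_support:
  assumes "x \<in> G" "y \<in> G" "spectral_kernel s n x y \<noteq> 0"
  shows "\<exists>p. path_from_to W x y p \<and> length p \<le> Suc n"
  using assms(2,3)
proof (induction n arbitrary: y)
  case 0
  then have "x = y" using kernel_0[OF assms(1)] by (auto split: if_splits)
  then show ?case using 0 by (intro exI[of _ "[x]"]) (auto simp: path_from_to_def verts_def)
next
  case (Suc n)
  show ?case
  proof (cases "spectral_kernel s n x y = 0")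
    case True
    from kernel_Suc_nonzero[OF assms(1) Suc.prems True] obtain w
      where w: "w \<in> G" "adj W w y" "spectral_kernel s n x w \<noteq> 0" .
    with Suc.IH obtain p where "path_from_to W x w p" "length p \<le> Suc n" by blast
    then show ?thesis
      using path_from_to_snoc[of W x w p y] w Suc.prems
      by (intro exI[of _ "p @ [y]"]) (auto simp: verts_def)
  next
    case False
    then show ?thesis using Suc.IH Suc.prems by (meson le_SucI)
  qed
qed

lemma kernel_boundary_support:
  assumes "x \<in> G" "z \<in> B" "spectral_kernel s n x z \<noteq> 0"
  shows "\<exists>p. path_from_to W x z p \<and> length p \<le> Suc (Suc n)"
proof -
  from kernel_boundary_nonzero[OF assms] obtain y
    where y: "y \<in> G" "adj W y z" "spectral_kernel s n x y \<noteq> 0" .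
  with kernel_inner_support[OF assms(1)] obtain p
    where "path_from_to W x y p" "length p \<le> Suc n" by blast
  then show ?thesis
    using path_from_to_snoc[of W x y p z] y assms(2)
    by (intro exI[of _ "p @ [z]"]) (auto simp: verts_def)
qed

lemma kernel_inner_path_pos:
  assumes "diagonal_bound s" "b \<noteq> []" "set b \<subseteq> G" "successively (adj W) b" "last b = x"
  shows "spectral_kernel s (length b - 1) x (hd b) > 0"
  using assms(2-)
proof (induction b)
  case (Cons y b)
  show ?case
  proof (cases "b = []")
    case True
    then show ?thesis using Cons.prems kernel_0[of x x] \<mu>_pos[of x] by (auto simp: verts_def)
  next
    case False
    then have "spectral_kernel s (length b - 1) x (hd b) > 0" "adj W y (hd b)"
      using Cons by (auto simp: successively_Cons)
    moreover have "x \<in> G" using Cons.prems by (metis last_in_set subsetD)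
    ultimately show ?thesis
      using kernel_Suc_pos[OF assms(1), of x y "hd b" "length b - 1"] Cons.prems False by auto
  qed
qed simp

text \<open>
  Distances count edges between boundary vertices, which the operator does not see. This is harmless:
  on a shortest path from \<open>z0\<close> to the extreme point \<open>x\<close>, let \<open>z\<close> be the last boundary vertex. The
  rest of the path is interior, so the kernel from \<open>x\<close> reaches \<open>z\<close> along it. If the kernel from
  another \<open>y \<in> S\<close> reached \<open>z\<close> within the same number of steps, then replacing the rest of the path by
  a path to \<open>y\<close> would bring \<open>y\<close> as near to \<open>z0\<close> as \<open>x\<close> is.
\<close>

lemma extreme_point_isolated_by_kernel:
  assumes s: "diagonal_bound s" and S: "S \<subseteq> G" and ex: "extreme_point_of_subset W S x"
    and nontrivial: "\<exists>y\<in>S. y \<noteq> x"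
  shows "\<exists>z\<in>B. \<exists>n. spectral_kernel s n x z > 0 \<and> (\<forall>y\<in>S - {x}. spectral_kernel s n y z = 0)"
proof -
  from ex obtain z0 where "x \<in> S" and z0: "z0 \<in> B"
    "\<And>y. y \<in> S - {x} \<Longrightarrow> graph_dist W z0 x < graph_dist W z0 y"
    by (auto simp: extreme_point_of_subset_def)
  have "x \<in> G" using \<open>x \<in> S\<close> S by blast
  obtain y0 where "y0 \<in> S - {x}" using nontrivial by blast
  then have "graph_dist W z0 x \<noteq> \<infinity>" using z0(2)[of y0] by (metis enat_ord_simps(6))
  then obtain p where p: "path_from_to W z0 x p" "graph_dist W z0 x = enat (length p - 1)"
    by (rule shortest_path)
  have path: "p \<noteq> []" "set p \<subseteq> verts W" "successively (adj W) p" "hd p = z0" "last p = x"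
    using p(1) by (auto simp: path_from_to_def)
  have "\<exists>v\<in>set p. v \<in> B" using path(1,4) z0(1) by (intro bexI[of _ "hd p"]) auto
  then obtain a z b where split: "p = a @ z # b" "z \<in> B" "\<forall>v\<in>set b. v \<notin> B"
    by (rule split_list_last_propE)
  have "b \<noteq> []" using path(5) split(1,2) \<open>x \<in> G\<close> disjoint by auto
  have "p = (a @ [z]) @ b" using split(1) by simp
  then have az: "successively (adj W) (a @ [z])" and zb: "successively (adj W) (z # b)"
    using path(3) split(1) by (metis successively_append_iff)+
  have b: "set b \<subseteq> G" "successively (adj W) b" "last b = x" "adj W z (hd b)"
    using path(2,5) split(1,3) zb \<open>b \<noteq> []\<close> by (auto simp: verts_def successively_Cons)
  \<comment> \<open>The path from \<open>z\<close> to \<open>x\<close> has \<open>length b\<close> edges; the one at \<open>z\<close> is covered by the Neumann condition.\<close>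
  let ?n = "length b - 1"
  have "spectral_kernel s ?n x z > 0"
    using kernel_boundary_pos[OF s \<open>x \<in> G\<close> split(2), of "hd b"]
      kernel_inner_path_pos[OF s \<open>b \<noteq> []\<close> b(1-3)] b(1,4) hd_in_set[OF \<open>b \<noteq> []\<close>]
    by (blast intro: adj_sym)
  moreover have "spectral_kernel s ?n y z = 0" if y: "y \<in> S - {x}" for y
  proof (rule ccontr)
    assume "spectral_kernel s ?n y z \<noteq> 0"
    then obtain r where r: "path_from_to W y z r" "length r \<le> Suc (Suc ?n)"
      using kernel_boundary_support[of y z s ?n] y S split(2) by blast
    have "path_from_to W z0 z (a @ [z])"
      using path(2,4) split(1) az by (cases a) (simp_all add: path_from_to_def)
    then have "path_from_to W z0 y (a @ rev r)"
      by (rule path_from_to_append_tl[OF _ path_from_to_rev[OF r(1)]])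
    then have "graph_dist W z0 y \<le> enat (length (a @ rev r) - 1)" by (rule graph_dist_le)
    also have "\<dots> \<le> enat (length p - 1)"
      using r(2) split(1) \<open>b \<noteq> []\<close> by (cases b) auto
    finally show False using z0(2)[OF that] p(2) by simp
  qed
  ultimately show ?thesis using split(2) by blast
qed

lemma adj_inner_iff_kernel:
  assumes "diagonal_bound s" "x \<in> G" "y \<in> G" "x \<noteq> y"
  shows "adj W x y \<longleftrightarrow> spectral_kernel s 1 x y \<noteq> 0"
proof
  assume "adj W x y"
  then have "spectral_kernel s (Suc 0) x y > 0"
    using assms kernel_0[of x x] \<mu>_pos[of x]
    by (intro kernel_Suc_pos[of s x y x]) (auto simp: verts_def intro: adj_sym)
  then show "spectral_kernel s 1 x y \<noteq> 0" by simp
next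
  assume "spectral_kernel s 1 x y \<noteq> 0"
  then obtain w where "w \<in> G" "adj W w y" "spectral_kernel s 0 x w \<noteq> 0"
    using kernel_Suc_nonzero[of x y s 0] assms kernel_0[of x y] by auto
  then show "adj W x y" using kernel_0[of x w] assms(2) by (auto split: if_splits)
qed

lemma adj_boundary_iff_kernel:
  assumes "diagonal_bound s" "x \<in> G" "z \<in> B"
  shows "adj W x z \<longleftrightarrow> spectral_kernel s 0 x z \<noteq> 0"
proof
  assume "adj W x z"
  then have "spectral_kernel s 0 x z > 0"
    using assms kernel_0[of x x] \<mu>_pos[of x]
    by (intro kernel_boundary_pos[of s x z x]) (auto simp: verts_def)
  then show "spectral_kernel s 0 x z \<noteq> 0" by simp
next
  assume "spectral_kernel s 0 x z \<noteq> 0"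
  then obtain y where "y \<in> G" "adj W y z" "spectral_kernel s 0 x y \<noteq> 0"
    using kernel_boundary_nonzero assms by blast
  then show "adj W x z" using kernel_0[of x y] assms(2) by (auto split: if_splits)
qed

lemma diagonal_bound_mono: "diagonal_bound s \<Longrightarrow> s \<le> t \<Longrightarrow> diagonal_bound t"
  by (force simp: diagonal_bound_def)

lemma diagonal_bound_exists: "\<exists>s. diagonal_bound s"
proof -
  have "bdd_above ((\<lambda>y. q y + 1 / \<mu> y * (\<Sum>w | w \<in> verts W \<and> adj W w y. g y w)) ` G)"
    by simp
  then show ?thesis unfolding diagonal_bound_def bdd_above_def by blast
qed

end

section \<open>Two graphs with the same boundary spectral data\<close>

lemma square_weight_factor:
  fixes m r :: real
  assumes "r * r = m"
  shows "(r * a * p) * (r * b * t) = a * b * (m * p * t)"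
    and "(a * r * p) * (b * r * t) = a * b * (m * p * t)"
    and "(r * a * p) * (r * t) = a * (m * p * t)"
  unfolding assms[symmetric] by (simp_all add: mult_ac)

locale isospectral_pair =
  left: neumann_eigenbasis W q ev \<phi> + right: neumann_eigenbasis W' q' ev' \<phi>'
  for W :: "'a wgraph" and q ev \<phi> and W' :: "'b wgraph" and q' ev' \<phi>' +
  fixes \<Phi>0 :: "'a \<Rightarrow> 'b"
  assumes same_size: "card (inner_verts W) = card (inner_verts W')"
    and boundary_bij: "bij_betw \<Phi>0 (bdry_verts W) (bdry_verts W')"
    and same_eigenvalues: "\<And>j. j \<in> {1..card (inner_verts W)} \<Longrightarrow> ev j = ev' j"
    and same_traces: "\<And>j z. j \<in> {1..card (inner_verts W)} \<Longrightarrow> z \<in> bdry_verts W \<Longrightarrow>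
      \<phi> j z = \<phi>' j (\<Phi>0 z)"
begin

abbreviation "J \<equiv> {1..card (inner_verts W)}"

text \<open>
  The matrix of inner products between the orthonormal bases \<open>(\<surd>\<mu>\<^sub>x \<phi>\<^sub>j(x))\<^sub>j\<close> and
  \<open>(\<surd>\<mu>'\<^sub>v \<phi>'\<^sub>j(v))\<^sub>j\<close> of \<open>\<real>\<^sup>J\<close>.
\<close>

definition overlap :: "'a \<Rightarrow> 'b \<Rightarrow> real" where
  "overlap x v =
     sqrt (vertex_weight W x) * sqrt (vertex_weight W' v) * (\<Sum>j\<in>J. \<phi> j x * \<phi>' j v)"

lemma overlap_rows:
  assumes "x \<in> inner_verts W" "y \<in> inner_verts W"
  shows "(\<Sum>v\<in>inner_verts W'. overlap x v * overlap y v) = (if x = y then 1 else 0)"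
proof -
  have "(\<Sum>v\<in>inner_verts W'. overlap x v * overlap y v) =
      sqrt (vertex_weight W x) * sqrt (vertex_weight W y) * (\<Sum>v\<in>inner_verts W'.
        vertex_weight W' v * (\<Sum>j\<in>J. \<phi> j x * \<phi>' j v) * (\<Sum>j\<in>J. \<phi> j y * \<phi>' j v))"
    unfolding sum_distrib_left[of "sqrt (vertex_weight W x) * sqrt (vertex_weight W y)"]
  proof (rule sum.cong)
    fix v assume "v \<in> inner_verts W'"
    then have "sqrt (vertex_weight W' v) * sqrt (vertex_weight W' v) = vertex_weight W' v"
      using right.\<mu>_pos[of v] by (simp add: verts_def less_imp_le)
    then show "overlap x v * overlap y v = sqrt (vertex_weight W x) * sqrt (vertex_weight W y) *
        (vertex_weight W' v * (\<Sum>j\<in>J. \<phi> j x * \<phi>' j v) * (\<Sum>j\<in>J. \<phi> j y * \<phi>' j v))"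
      unfolding overlap_def by (rule square_weight_factor(2))
  qed simp
  also have "\<dots> = sqrt (vertex_weight W x) * sqrt (vertex_weight W y) * (\<Sum>j\<in>J. \<phi> j x * \<phi> j y)"
    using right.parseval[of "\<lambda>j. \<phi> j x" "\<lambda>j. \<phi> j y"] same_size by simp
  also have "\<dots> = (if x = y then 1 else 0)"
    using left.completeness[OF assms] left.\<mu>_pos[of x] assms(1)
    by (auto simp: verts_def less_imp_le split: if_splits)
  finally show ?thesis .
qed

lemma overlap_columns:
  assumes "u \<in> inner_verts W'" "v \<in> inner_verts W'"
  shows "(\<Sum>x\<in>inner_verts W. overlap x u * overlap x v) = (if u = v then 1 else 0)"
proof -
  have "(\<Sum>x\<in>inner_verts W. overlap x u * overlap x v) =
      sqrt (vertex_weight W' u) * sqrt (vertex_weight W' v) * (\<Sum>x\<in>inner_verts W.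
        vertex_weight W x * (\<Sum>j\<in>J. \<phi>' j u * \<phi> j x) * (\<Sum>j\<in>J. \<phi>' j v * \<phi> j x))"
    unfolding sum_distrib_left[of "sqrt (vertex_weight W' u) * sqrt (vertex_weight W' v)"]
  proof (rule sum.cong)
    fix x assume "x \<in> inner_verts W"
    then have "sqrt (vertex_weight W x) * sqrt (vertex_weight W x) = vertex_weight W x"
      using left.\<mu>_pos[of x] by (simp add: verts_def less_imp_le)
    then show "overlap x u * overlap x v = sqrt (vertex_weight W' u) * sqrt (vertex_weight W' v) *
        (vertex_weight W x * (\<Sum>j\<in>J. \<phi>' j u * \<phi> j x) * (\<Sum>j\<in>J. \<phi>' j v * \<phi> j x))"
      unfolding overlap_def mult.commute[of "\<phi>' _ _"] by (rule square_weight_factor(1))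
  qed simp
  also have "\<dots> = sqrt (vertex_weight W' u) * sqrt (vertex_weight W' v) * (\<Sum>j\<in>J. \<phi>' j u * \<phi>' j v)"
    using left.parseval[of "\<lambda>j. \<phi>' j u" "\<lambda>j. \<phi>' j v"] by simp
  also have "\<dots> = (if u = v then 1 else 0)"
    using right.completeness[OF assms] right.\<mu>_pos[of u] assms(1) same_size
    by (auto simp: verts_def less_imp_le split: if_splits)
  finally show ?thesis .
qed

text \<open>
  The two sides are the coordinates of one vector, \<open>((s - \<lambda>\<^sub>j)\<^sup>n \<phi>\<^sub>j(z))\<^sub>j\<close>, with respect to
  the two bases. The vector is common to both graphs because it consists of boundary spectral data.
\<close>

lemma overlap_transports_kernel:
  assumes "v \<in> inner_verts W'" "z \<in> bdry_verts W"
  shows "sqrt (vertex_weight W' v) * right.spectral_kernel s n v (\<Phi>0 z) =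
    (\<Sum>x\<in>inner_verts W. overlap x v * (sqrt (vertex_weight W x) * left.spectral_kernel s n x z))"
proof -
  have "(\<Sum>x\<in>inner_verts W. overlap x v * (sqrt (vertex_weight W x) * left.spectral_kernel s n x z)) =
      sqrt (vertex_weight W' v) * (\<Sum>x\<in>inner_verts W. vertex_weight W x *
        (\<Sum>j\<in>J. \<phi>' j v * \<phi> j x) * (\<Sum>j\<in>J. ((s - ev j) ^ n * \<phi> j z) * \<phi> j x))"
    unfolding sum_distrib_left[of "sqrt (vertex_weight W' v)"]
  proof (rule sum.cong)
    fix x assume "x \<in> inner_verts W"
    then have sq: "sqrt (vertex_weight W x) * sqrt (vertex_weight W x) = vertex_weight W x"
      using left.\<mu>_pos[of x] by (simp add: verts_def less_imp_le)
    have "left.spectral_kernel s n x z = (\<Sum>j\<in>J. ((s - ev j) ^ n * \<phi> j z) * \<phi> j x)"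
      by (simp add: left.spectral_kernel_def mult_ac)
    then show "overlap x v * (sqrt (vertex_weight W x) * left.spectral_kernel s n x z) =
        sqrt (vertex_weight W' v) * (vertex_weight W x *
        (\<Sum>j\<in>J. \<phi>' j v * \<phi> j x) * (\<Sum>j\<in>J. ((s - ev j) ^ n * \<phi> j z) * \<phi> j x))"
      unfolding overlap_def mult.commute[of "\<phi>' _ v"]
      by (simp only: square_weight_factor(3)[OF sq])
  qed simp
  also have "\<dots> = sqrt (vertex_weight W' v) * (\<Sum>j\<in>J. \<phi>' j v * ((s - ev j) ^ n * \<phi> j z))"
    using left.parseval[of "\<lambda>j. \<phi>' j v" "\<lambda>j. (s - ev j) ^ n * \<phi> j z"] by simp
  also have "\<dots> = sqrt (vertex_weight W' v) * right.spectral_kernel s n v (\<Phi>0 z)"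
    using same_eigenvalues same_traces assms(2) same_size
    by (auto simp: right.spectral_kernel_def mult_ac intro!: sum.cong)
  finally show ?thesis by simp
qed

text \<open>
  Proportionality, rather than equality, of the eigenfunction values is what can be expected: the
  vertex weights of the two graphs may differ.
\<close>

definition matched :: "'a \<Rightarrow> 'b \<Rightarrow> bool" where
  "matched x v \<longleftrightarrow> (\<exists>\<kappa>. \<kappa> \<noteq> 0 \<and> (\<forall>j\<in>J. \<phi>' j v = \<kappa> * \<phi> j x))"

text \<open>
  Expanding the vector \<open>(\<phi>'\<^sub>j(v))\<^sub>j\<close> in the basis of the left graph leaves only the term at \<open>x\<close>.
\<close>

lemma single_overlap_matched:
  assumes "x \<in> inner_verts W" "v \<in> inner_verts W'"
    and "overlap x v \<noteq> 0" "\<And>y. y \<in> inner_verts W - {x} \<Longrightarrow> overlap y v = 0"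
  shows "matched x v"
proof -
  let ?c = "\<lambda>y. \<Sum>i\<in>J. \<phi> i y * \<phi>' i v"
  have vanish: "?c y = 0" if "y \<in> inner_verts W - {x}" for y
  proof -
    have "vertex_weight W y > 0" "vertex_weight W' v > 0"
      using that assms(2) left.\<mu>_pos right.\<mu>_pos by (auto simp: verts_def)
    then show ?thesis using assms(4)[OF that] unfolding overlap_def by auto
  qed
  have "\<phi>' j v = (vertex_weight W x * ?c x) * \<phi> j x" if "j \<in> J" for j
  proof -
    \<comment> \<open>Parseval's identity against the \<open>j\<close>-th unit vector extracts the \<open>j\<close>-th component.\<close>
    have "(\<Sum>i\<in>J. (if i = j then 1 else 0) * \<phi> i y) = \<phi> j y" for y
      using that by (simp add: if_distrib[of "\<lambda>c. c * _"] cong: if_cong)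
    moreover have "(\<Sum>i\<in>J. \<phi>' i v * (if i = j then 1 else 0)) = \<phi>' j v"
      using that by (simp add: if_distrib[of "\<lambda>c. _ * c"] cong: if_cong)
    ultimately have "\<phi>' j v = (\<Sum>y\<in>inner_verts W. vertex_weight W y * ?c y * \<phi> j y)"
      using left.parseval[of "\<lambda>i. \<phi>' i v" "\<lambda>i. if i = j then 1 else 0"]
      by (simp only: mult.commute[of "\<phi>' _ v"])
    also have "\<dots> = (\<Sum>y\<in>{x}. vertex_weight W y * ?c y * \<phi> j y)"
      using assms(1) vanish by (intro sum.mono_neutral_right) auto
    finally show ?thesis by simp
  qed
  moreover have "vertex_weight W x * ?c x \<noteq> 0"
    using assms(3) unfolding overlap_def by auto
  ultimately show ?thesis unfolding matched_def by blast
qed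

text \<open>Basis vectors of distinct vertices are orthogonal, hence not proportional.\<close>

lemma matched_injective:
  assumes "x \<in> inner_verts W" "y \<in> inner_verts W" "matched x v" "matched y v"
  shows "x = y"
proof (rule ccontr)
  assume "x \<noteq> y"
  obtain \<kappa> \<kappa>' where \<kappa>: "\<kappa> \<noteq> 0"
    "\<And>j. j \<in> J \<Longrightarrow> \<phi>' j v = \<kappa> * \<phi> j x" "\<And>j. j \<in> J \<Longrightarrow> \<phi>' j v = \<kappa>' * \<phi> j y"
    using assms(3,4) unfolding matched_def by blast
  have "\<kappa> * (\<Sum>j\<in>J. \<phi> j x * \<phi> j x) = (\<Sum>j\<in>J. \<phi>' j v * \<phi> j x)"
    using \<kappa>(2) by (simp add: sum_distrib_left mult.assoc)
  also have "\<dots> = \<kappa>' * (\<Sum>j\<in>J. \<phi> j x * \<phi> j y)"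
    using \<kappa>(3) by (simp add: sum_distrib_left mult_ac)
  also have "(\<Sum>j\<in>J. \<phi> j x * \<phi> j y) = 0"
    using left.completeness[OF assms(1,2)] left.\<mu>_pos[of x] assms(1) \<open>x \<noteq> y\<close>
    by (auto simp: verts_def)
  finally show False
    using \<kappa>(1) left.completeness[OF assms(1,1)] by auto
qed

lemma matched_kernel_inner:
  assumes "matched x u" "matched y v"
  shows "right.spectral_kernel s n u v \<noteq> 0 \<longleftrightarrow> left.spectral_kernel s n x y \<noteq> 0"
proof -
  obtain \<kappa> \<kappa>' where \<kappa>: "\<kappa> \<noteq> 0" "\<kappa>' \<noteq> 0"
    "\<And>j. j \<in> J \<Longrightarrow> \<phi>' j u = \<kappa> * \<phi> j x" "\<And>j. j \<in> J \<Longrightarrow> \<phi>' j v = \<kappa>' * \<phi> j y"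
    using assms unfolding matched_def by blast
  have "right.spectral_kernel s n u v = \<kappa> * \<kappa>' * left.spectral_kernel s n x y"
    unfolding right.spectral_kernel_def left.spectral_kernel_def same_size[symmetric] sum_distrib_left
    by (intro sum.cong refl) (simp only: \<kappa>(3,4) same_eigenvalues mult_ac)
  then show ?thesis using \<kappa> by simp
qed

lemma matched_kernel_boundary:
  assumes "matched x v" "z \<in> bdry_verts W"
  shows "right.spectral_kernel s n v (\<Phi>0 z) \<noteq> 0 \<longleftrightarrow> left.spectral_kernel s n x z \<noteq> 0"
proof -
  obtain \<kappa> where \<kappa>: "\<kappa> \<noteq> 0" "\<And>j. j \<in> J \<Longrightarrow> \<phi>' j v = \<kappa> * \<phi> j x"
    using assms unfolding matched_def by blast
  have "right.spectral_kernel s n v (\<Phi>0 z) = \<kappa> * left.spectral_kernel s n x z"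
    unfolding right.spectral_kernel_def left.spectral_kernel_def same_size[symmetric] sum_distrib_left
    using assms(2) by (intro sum.cong refl) (simp add: \<kappa>(2) same_eigenvalues same_traces mult_ac)
  then show ?thesis using \<kappa> by simp
qed

lemma common_diagonal_bound: "\<exists>s. left.diagonal_bound s \<and> right.diagonal_bound s"
  using left.diagonal_bound_exists right.diagonal_bound_exists
  by (meson left.diagonal_bound_mono right.diagonal_bound_mono max.cobounded1 max.cobounded2)

text \<open>
  The matrix lemma applies to the overlap matrix, with the kernels at boundary vertices as
  nonnegative vectors: positivity holds in both graphs for a common shift, and the extreme points
  supplied by the Two-Points Condition are isolated.
\<close>

lemma every_inner_vertex_matched:
  assumes two_points: "two_points_condition W" and x: "x \<in> inner_verts W"
  shows "\<exists>v\<in>inner_verts W'. matched x v"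
proof -
  obtain s where s: "left.diagonal_bound s" "right.diagonal_bound s"
    using common_diagonal_bound by blast
  let ?a = "\<lambda>(z, n) x. sqrt (vertex_weight W x) * left.spectral_kernel s n x z"
  let ?b = "\<lambda>(z, n) v. sqrt (vertex_weight W' v) * right.spectral_kernel s n v (\<Phi>0 z)"
  have "\<exists>v\<in>inner_verts W'. overlap x v \<noteq> 0 \<and> (\<forall>y\<in>inner_verts W - {x}. overlap y v = 0)"
  proof (rule nonneg_isolating_orthogonal_matrix_is_monomial
      [where a = ?a and b = ?b and I = "bdry_verts W \<times> UNIV"])
    show "?a i x \<ge> 0" if "i \<in> bdry_verts W \<times> UNIV" "x \<in> inner_verts W" for i x
      using that left.kernel_nonneg[OF s(1)] left.\<mu>_pos
      by (auto simp: verts_def less_imp_le)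
    show "?b i v \<ge> 0" if "i \<in> bdry_verts W \<times> UNIV" "v \<in> inner_verts W'" for i v
      using that right.kernel_nonneg[OF s(2)] right.\<mu>_pos bij_betw_apply[OF boundary_bij]
      by (auto simp: verts_def less_imp_le)
    show "?b i v = (\<Sum>x\<in>inner_verts W. overlap x v * ?a i x)"
      if "i \<in> bdry_verts W \<times> UNIV" "v \<in> inner_verts W'" for i v
      using that overlap_transports_kernel by auto
    fix S assume S: "S \<subseteq> inner_verts W" "\<exists>x\<in>S. \<exists>y\<in>S. x \<noteq> y"
    have isolated: "\<exists>i\<in>bdry_verts W \<times> UNIV. ?a i x > 0 \<and> (\<forall>w\<in>S - {x}. ?a i w = 0)"
      if ext: "extreme_point_of_subset W S x" for x
    proof -
      have "x \<in> S" using ext by (simp add: extreme_point_of_subset_def)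
      have "\<exists>y\<in>S. y \<noteq> x" using S(2) by metis
      then obtain z n where "z \<in> bdry_verts W" "left.spectral_kernel s n x z > 0"
        "\<forall>y\<in>S - {x}. left.spectral_kernel s n y z = 0"
        using left.extreme_point_isolated_by_kernel[OF s(1) S(1) ext] by blast
      then show ?thesis
        using left.\<mu>_pos[of x] \<open>x \<in> S\<close> S(1) by (intro bexI[of _ "(z, n)"]) (auto simp: verts_def)
    qed
    obtain x y where xy: "x \<noteq> y" "extreme_point_of_subset W S x" "extreme_point_of_subset W S y"
      using two_points S unfolding two_points_condition_def by blast
    moreover have "x \<in> S" "y \<in> S" using xy by (auto simp: extreme_point_of_subset_def)
    ultimately show "\<exists>x\<in>S. \<exists>y\<in>S. x \<noteq> y \<and>
        (\<exists>i\<in>bdry_verts W \<times> UNIV. ?a i x > 0 \<and> (\<forall>w\<in>S - {x}. ?a i w = 0)) \<and>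
        (\<exists>i\<in>bdry_verts W \<times> UNIV. ?a i y > 0 \<and> (\<forall>w\<in>S - {y}. ?a i w = 0))"
      using isolated[of x] isolated[of y] by blast
  qed (use overlap_rows overlap_columns x in auto)
  then show ?thesis using single_overlap_matched[OF x] by blast
qed

lemma inner_bijection:
  assumes "two_points_condition W"
  obtains \<Psi> where "bij_betw \<Psi> (inner_verts W) (inner_verts W')"
    "\<And>x. x \<in> inner_verts W \<Longrightarrow> matched x (\<Psi> x)"
proof -
  obtain \<Psi> where \<Psi>: "\<forall>x\<in>inner_verts W. \<Psi> x \<in> inner_verts W' \<and> matched x (\<Psi> x)"
    using every_inner_vertex_matched[OF assms] by metis
  have "inj_on \<Psi> (inner_verts W)"
    using \<Psi> matched_injective by (metis inj_onI)
  moreover from this have "\<Psi> ` inner_verts W = inner_verts W'"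
    using \<Psi> same_size by (intro card_subset_eq) (auto simp: card_image)
  ultimately show ?thesis using that \<Psi> by (simp add: bij_betw_def)
qed

end

section \<open>Reconstruction of the graph\<close>

theorem theorem1:
  fixes W :: "'a wgraph" and W' :: "'b wgraph"
    and q :: "'a \<Rightarrow> real" and q' :: "'b \<Rightarrow> real"
    and \<Phi>0 :: "'a \<Rightarrow> 'b"
  assumes "weighted_graph_with_boundary W" and "weighted_graph_with_boundary W'"
    and "finite_wgraph W" and "finite_wgraph W'"
    and "strongly_connected_wgraph W" and "strongly_connected_wgraph W'"
    and "two_points_condition W" and "two_points_condition W'"
    and "boundary_triangle_condition W" and "boundary_triangle_condition W'"
    and "spectrally_isomorphic W q W' q' \<Phi>0"
  shows "\<exists>\<Phi>. bij_betw \<Phi> (verts W) (verts W') \<and>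
           (\<forall>z\<in>bdry_verts W. \<Phi> z = \<Phi>0 z) \<and>
           (\<forall>x1\<in>verts W. \<forall>x2\<in>verts W. adj W x1 x2 \<longleftrightarrow> adj W' (\<Phi> x1) (\<Phi> x2))"
proof -
  have \<Phi>0: "bij_betw \<Phi>0 (bdry_verts W) (bdry_verts W')"
    "\<And>z y. z \<in> bdry_verts W \<Longrightarrow> y \<in> bdry_verts W \<Longrightarrow> adj W y z \<longleftrightarrow> adj W' (\<Phi>0 y) (\<Phi>0 z)"
    and size: "card (inner_verts W) = card (inner_verts W')"
    using assms(11) unfolding spectrally_isomorphic_def boundary_isomorphism_def bdry_nbhd_def
    by blast+
  obtain ev \<phi> ev' \<phi>' where data: "neumann_boundary_spectral_data W q ev \<phi>"
    "neumann_boundary_spectral_data W' q' ev' \<phi>'"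
    "\<forall>j\<in>{1..card (inner_verts W)}. ev j = ev' j \<and> (\<forall>z\<in>bdry_verts W. \<phi> j z = \<phi>' j (\<Phi>0 z))"
    using assms(11) unfolding spectrally_isomorphic_def by blast
  interpret isospectral_pair W q ev \<phi> W' q' ev' \<phi>' \<Phi>0
    by (intro isospectral_pair.intro neumann_eigenbasis.intro isospectral_pair_axioms.intro)
      (use assms(1-6,9,10) data \<Phi>0(1) size in blast)+
  obtain s where s: "left.diagonal_bound s" "right.diagonal_bound s"
    using common_diagonal_bound by blast
  obtain \<Psi> where \<Psi>: "bij_betw \<Psi> (inner_verts W) (inner_verts W')"
    "\<And>x. x \<in> inner_verts W \<Longrightarrow> matched x (\<Psi> x)"
    by (rule inner_bijection[OF assms(7)]) blast
  define \<Phi> where "\<Phi> x = (if x \<in> inner_verts W then \<Psi> x else \<Phi>0 x)" for x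
  have inner: "\<Phi> x = \<Psi> x" "\<Phi> x \<in> inner_verts W'" if "x \<in> inner_verts W" for x
    using that bij_betw_apply[OF \<Psi>(1)] by (auto simp: \<Phi>_def)
  have bdry: "\<Phi> z = \<Phi>0 z" "\<Phi> z \<in> bdry_verts W'" if "z \<in> bdry_verts W" for z
    using that left.disjoint bij_betw_apply[OF \<Phi>0(1)] by (auto simp: \<Phi>_def)
  have "bij_betw \<Phi> (inner_verts W) (inner_verts W')"
    using \<Psi>(1) inner(1) bij_betw_cong[of "inner_verts W" \<Phi> \<Psi>] by blast
  moreover have "bij_betw \<Phi> (bdry_verts W) (bdry_verts W')"
    using \<Phi>0(1) bdry(1) bij_betw_cong[of "bdry_verts W" \<Phi> \<Phi>0] by blast
  ultimately have bij: "bij_betw \<Phi> (verts W) (verts W')"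
    unfolding verts_def using right.disjoint by (rule bij_betw_combine)
  have inner_inner: "adj W x y \<longleftrightarrow> adj W' (\<Phi> x) (\<Phi> y)"
    if "x \<in> inner_verts W" "y \<in> inner_verts W" for x y
  proof (cases "x = y")
    case True
    then show ?thesis using left.adj_verts right.adj_verts by blast
  next
    case False
    then have "\<Phi> x \<noteq> \<Phi> y"
      using that bij by (metis UnI1 bij_betw_def inj_onD verts_def)
    with False that show ?thesis
      using left.adj_inner_iff_kernel[OF s(1) that]
        right.adj_inner_iff_kernel[OF s(2) inner(2) inner(2), OF that]
        matched_kernel_inner[OF \<Psi>(2) \<Psi>(2), OF that] inner(1) by simp
  qed
  have inner_bdry: "adj W x z \<longleftrightarrow> adj W' (\<Phi> x) (\<Phi> z)"
    if "x \<in> inner_verts W" "z \<in> bdry_verts W" for x z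
    using left.adj_boundary_iff_kernel[OF s(1) that]
      right.adj_boundary_iff_kernel[OF s(2) inner(2) bdry(2), OF that]
      matched_kernel_boundary[OF \<Psi>(2), OF that] inner(1)[OF that(1)] bdry(1)[OF that(2)] by simp
  have bdry_bdry: "adj W y z \<longleftrightarrow> adj W' (\<Phi> y) (\<Phi> z)"
    if "y \<in> bdry_verts W" "z \<in> bdry_verts W" for y z
    using \<Phi>0(2)[of z y] bdry(1) that by simp
  have bdry_inner: "adj W z x \<longleftrightarrow> adj W' (\<Phi> z) (\<Phi> x)"
    if "x \<in> inner_verts W" "z \<in> bdry_verts W" for x z
    using inner_bdry[OF that] by (blast intro: adj_sym)
  have "\<forall>x\<in>verts W. \<forall>y\<in>verts W. adj W x y \<longleftrightarrow> adj W' (\<Phi> x) (\<Phi> y)"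
    unfolding verts_def using inner_inner inner_bdry bdry_inner bdry_bdry by blast
  then show ?thesis using bij bdry(1) by blast
qed

end
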